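(* The lattice $K$ (defined in the context) has the following properties: (i) $K$ is infinite, generated by three elements, and $2$-modular; (ii) for every positive integer $h$, $K$ is $\mathbf{M}^h$-amenable, that is, $K\otimes L$ is a capped tensor product for every $h$-modular lattice $L$ with zero.
   Context: $K$ is the lattice consisting of $\varnothing$, $C=\{c\}$, $A_m=\{a_k:k\geq m\}$, $B_n=\{b_k:k\geq n\}$ ($m,n<\omega$), and the sets $C\cup A_m\cup B_n$ with $m,n<\omega$, $|m-n|\leq1$, all ordered by inclusion (here $c,a_n,b_n$ are distinct symbols); meets are intersections. For a lattice $L$, define $\langle x,y,z\rangle^{(1)}=\langle x\vee(y\wedge z),y\vee(x\wedge z),z\vee(x\wedge y)\rangle$ on $L^3$, $u^{(0)}=u$, $u^{(k+1)}=(u^{(k)})^{(1)}$; $L$ is $h$-modular if $u^{(h+1)}=u^{(h)}$ for all $u\in L^3$. Tensor products: for join-semilattices with zero $A,B$, a bi-ideal of $A\times B$ is a down-set containing $(A\times\{0\})\cup(\{0\}\times B)$ and closed under lateral joins (joins of pairs $\langle a_0,b_0\rangle,\langle a_1,b_1\rangle$ with $a_0=a_1$ or $b_0=b_1$); $A\otimes B$ is the join-semilattice of compact elements of the algebraic lattice of all bi-ideals. A bi-ideal $I$ is capped if there is a finite $\Gamma\subseteq A\times B$ such that $I$ is the down-set generated by $\Gamma\cup(A\times\{0\})\cup(\{0\}\times B)$; $A\otimes B$ is a capped tensor product if all its elements are capped. *)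

theory Defs
  imports Main
begin

datatype ksym = Cs | As nat | Bs nat

definition Aset :: "nat \<Rightarrow> ksym set" where
  "Aset m = {As k | k. k \<ge> m}"

definition Bset :: "nat \<Rightarrow> ksym set" where
  "Bset n = {Bs k | k. k \<ge> n}"

definition Kcar :: "ksym set set" where
  "Kcar = {{}, {Cs}} \<union> range Aset \<union> range Bset
          \<union> {{Cs} \<union> Aset m \<union> Bset n | m n. m \<le> n + 1 \<and> n \<le> m + 1}"

definition Kmeet :: "ksym set \<Rightarrow> ksym set \<Rightarrow> ksym set" where
  "Kmeet x y = x \<inter> y"

definition Kjoin :: "ksym set \<Rightarrow> ksym set \<Rightarrow> ksym set" where
  "Kjoin x y = (THE z. z \<in> Kcar \<and> x \<union> y \<subseteq> z \<and> (\<forall>w\<in>Kcar. x \<union> y \<subseteq> w \<longrightarrow> z \<subseteq> w))"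

inductive_set gen_sublattice :: "'a set \<Rightarrow> ('a \<Rightarrow> 'a \<Rightarrow> 'a) \<Rightarrow> ('a \<Rightarrow> 'a \<Rightarrow> 'a) \<Rightarrow> 'a set \<Rightarrow> 'a set"
  for S :: "'a set" and jn :: "'a \<Rightarrow> 'a \<Rightarrow> 'a" and mt :: "'a \<Rightarrow> 'a \<Rightarrow> 'a" and X :: "'a set" where
  gen_base: "x \<in> X \<Longrightarrow> x \<in> gen_sublattice S jn mt X"
| gen_join: "x \<in> gen_sublattice S jn mt X \<Longrightarrow> y \<in> gen_sublattice S jn mt X \<Longrightarrow> jn x y \<in> gen_sublattice S jn mt X"
| gen_meet: "x \<in> gen_sublattice S jn mt X \<Longrightarrow> y \<in> gen_sublattice S jn mt X \<Longrightarrow> mt x y \<in> gen_sublattice S jn mt X"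

definition generated_by_three :: "'a set \<Rightarrow> ('a \<Rightarrow> 'a \<Rightarrow> 'a) \<Rightarrow> ('a \<Rightarrow> 'a \<Rightarrow> 'a) \<Rightarrow> bool" where
  "generated_by_three S jn mt \<longleftrightarrow>
     (\<exists>x\<in>S. \<exists>y\<in>S. \<exists>z\<in>S. gen_sublattice S jn mt {x, y, z} = S)"

definition hstep :: "('a \<Rightarrow> 'a \<Rightarrow> 'a) \<Rightarrow> ('a \<Rightarrow> 'a \<Rightarrow> 'a) \<Rightarrow> 'a \<times> 'a \<times> 'a \<Rightarrow> 'a \<times> 'a \<times> 'a" where
  "hstep jn mt u = (case u of (x, y, z) \<Rightarrow>
      (jn x (mt y z), jn y (mt x z), jn z (mt x y)))"

definition h_modular :: "nat \<Rightarrow> 'a set \<Rightarrow> ('a \<Rightarrow> 'a \<Rightarrow> 'a) \<Rightarrow> ('a \<Rightarrow> 'a \<Rightarrow> 'a) \<Rightarrow> bool" where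
  "h_modular h S jn mt \<longleftrightarrow>
     (\<forall>x\<in>S. \<forall>y\<in>S. \<forall>z\<in>S. (hstep jn mt ^^ (h + 1)) (x, y, z) = (hstep jn mt ^^ h) (x, y, z))"

text \<open>A join-semilattice with zero is given by a carrier S, a join jn and a zero z;
  its order is  a \<le> b  iff  jn a b = b.\<close>

definition jle :: "('a \<Rightarrow> 'a \<Rightarrow> 'a) \<Rightarrow> 'a \<Rightarrow> 'a \<Rightarrow> bool" where
  "jle jn a b \<longleftrightarrow> jn a b = b"

definition biideal ::
  "'a set \<Rightarrow> ('a \<Rightarrow> 'a \<Rightarrow> 'a) \<Rightarrow> 'a \<Rightarrow> 'b set \<Rightarrow> ('b \<Rightarrow> 'b \<Rightarrow> 'b) \<Rightarrow> 'b \<Rightarrow> ('a \<times> 'b) set \<Rightarrow> bool" where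
  "biideal SA jA zA SB jB zB I \<longleftrightarrow>
     I \<subseteq> SA \<times> SB
   \<and> (\<forall>a b a' b'. (a, b) \<in> I \<and> a' \<in> SA \<and> b' \<in> SB \<and> jle jA a' a \<and> jle jB b' b \<longrightarrow> (a', b') \<in> I)
   \<and> (SA \<times> {zB}) \<union> ({zA} \<times> SB) \<subseteq> I
   \<and> (\<forall>a b0 b1. (a, b0) \<in> I \<and> (a, b1) \<in> I \<longrightarrow> (a, jB b0 b1) \<in> I)
   \<and> (\<forall>a0 a1 b. (a0, b) \<in> I \<and> (a1, b) \<in> I \<longrightarrow> (jA a0 a1, b) \<in> I)"

text \<open>Join in the (complete) lattice of bi-ideals: the bi-ideal generated by a set.\<close>
definition biideal_closure ::
  "'a set \<Rightarrow> ('a \<Rightarrow> 'a \<Rightarrow> 'a) \<Rightarrow> 'a \<Rightarrow> 'b set \<Rightarrow> ('b \<Rightarrow> 'b \<Rightarrow> 'b) \<Rightarrow> 'b \<Rightarrow> ('a \<times> 'b) set \<Rightarrow> ('a \<times> 'b) set" where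
  "biideal_closure SA jA zA SB jB zB X = \<Inter>{I. biideal SA jA zA SB jB zB I \<and> X \<subseteq> I}"

text \<open>Compact elements of the lattice of bi-ideals = elements of the tensor product.\<close>
definition tensor_elem ::
  "'a set \<Rightarrow> ('a \<Rightarrow> 'a \<Rightarrow> 'a) \<Rightarrow> 'a \<Rightarrow> 'b set \<Rightarrow> ('b \<Rightarrow> 'b \<Rightarrow> 'b) \<Rightarrow> 'b \<Rightarrow> ('a \<times> 'b) set \<Rightarrow> bool" where
  "tensor_elem SA jA zA SB jB zB I \<longleftrightarrow>
     biideal SA jA zA SB jB zB I
   \<and> (\<forall>F. (\<forall>J\<in>F. biideal SA jA zA SB jB zB J)
          \<and> I \<subseteq> biideal_closure SA jA zA SB jB zB (\<Union>F)
          \<longrightarrow> (\<exists>G\<subseteq>F. finite G \<and> I \<subseteq> biideal_closure SA jA zA SB jB zB (\<Union>G)))"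

definition prod_downset ::
  "'a set \<Rightarrow> ('a \<Rightarrow> 'a \<Rightarrow> 'a) \<Rightarrow> 'b set \<Rightarrow> ('b \<Rightarrow> 'b \<Rightarrow> 'b) \<Rightarrow> ('a \<times> 'b) set \<Rightarrow> ('a \<times> 'b) set" where
  "prod_downset SA jA SB jB X =
     {(a, b). a \<in> SA \<and> b \<in> SB \<and> (\<exists>(a', b')\<in>X. jle jA a a' \<and> jle jB b b')}"

definition capped ::
  "'a set \<Rightarrow> ('a \<Rightarrow> 'a \<Rightarrow> 'a) \<Rightarrow> 'a \<Rightarrow> 'b set \<Rightarrow> ('b \<Rightarrow> 'b \<Rightarrow> 'b) \<Rightarrow> 'b \<Rightarrow> ('a \<times> 'b) set \<Rightarrow> bool" where
  "capped SA jA zA SB jB zB I \<longleftrightarrow>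
     (\<exists>\<Gamma>. finite \<Gamma> \<and> \<Gamma> \<subseteq> SA \<times> SB \<and>
        I = prod_downset SA jA SB jB (\<Gamma> \<union> (SA \<times> {zB}) \<union> ({zA} \<times> SB)))"

definition capped_tensor ::
  "'a set \<Rightarrow> ('a \<Rightarrow> 'a \<Rightarrow> 'a) \<Rightarrow> 'a \<Rightarrow> 'b set \<Rightarrow> ('b \<Rightarrow> 'b \<Rightarrow> 'b) \<Rightarrow> 'b \<Rightarrow> bool" where
  "capped_tensor SA jA zA SB jB zB \<longleftrightarrow>
     (\<forall>I. tensor_elem SA jA zA SB jB zB I \<longrightarrow> capped SA jA zA SB jB zB I)"

end

theory Submission
  imports Defs
begin

text \<open>The members of \<open>K\<close> are exactly the sets closed under the rules
  \<open>As m \<rightarrow> As (m+1)\<close>, \<open>Bs m \<rightarrow> Bs (m+1)\<close>, \<open>As m, Bs m \<rightarrow> Cs\<close>, \<open>Cs, As m \<rightarrow> Bs (m+1)\<close> and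
  \<open>Cs, Bs m \<rightarrow> As (m+1)\<close>.  Hence a bi-ideal of \<open>K \<times> L\<close> whose sections are principal amounts to a
  function \<open>f\<close> from symbols to \<open>L\<close> turning these rules into inequalities, such as
  \<open>f Cs \<sqinter> f (As m) \<le> f (Bs (m+1))\<close>.  A finitely generated bi-ideal starts from sequences
  \<open>f (As m)\<close>, \<open>f (Bs m)\<close> that are constant from some \<open>N\<close> on, and beyond \<open>N\<close> the rules force precisely
  the iteration \<open>u \<mapsto> u\<^sup>(\<^sup>1\<^sup>)\<close> on the triple of the values at \<open>Cs\<close>, \<open>As N\<close>, \<open>Bs N\<close>.  In an \<open>h\<close>-modular
  lattice this stops after \<open>h\<close> steps, so \<open>f\<close> exists and is constant beyond \<open>N + h\<close>, which gives a
  finite cap.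

  For \<open>2\<close>-modularity: a triple with two comparable entries is stable after two steps in any lattice,
  sets containing \<open>Cs\<close> form a distributive sublattice (their joins are unions), and an antichain in \<open>K\<close>
  either has pairwise meets \<open>{}\<close> or enters that sublattice after one step.\<close>

section \<open>Members of K as closed sets\<close>

definition Kclosed :: "ksym set \<Rightarrow> bool" where
  "Kclosed T \<longleftrightarrow>
     (\<forall>m. As m \<in> T \<longrightarrow> As (Suc m) \<in> T) \<and>
     (\<forall>m. Bs m \<in> T \<longrightarrow> Bs (Suc m) \<in> T) \<and>
     (\<forall>m. As m \<in> T \<longrightarrow> Bs m \<in> T \<longrightarrow> Cs \<in> T) \<and>
     (\<forall>m. Cs \<in> T \<longrightarrow> As m \<in> T \<longrightarrow> Bs (Suc m) \<in> T) \<and>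
     (\<forall>m. Cs \<in> T \<longrightarrow> Bs m \<in> T \<longrightarrow> As (Suc m) \<in> T)"

lemma mem_Aset [simp]: "As k \<in> Aset m \<longleftrightarrow> m \<le> k" "Bs k \<notin> Aset m" "Cs \<notin> Aset m"
  by (auto simp: Aset_def)

lemma mem_Bset [simp]: "Bs k \<in> Bset m \<longleftrightarrow> m \<le> k" "As k \<notin> Bset m" "Cs \<notin> Bset m"
  by (auto simp: Bset_def)

lemma Aset_mono: "m \<le> k \<Longrightarrow> Aset k \<subseteq> Aset m" and Bset_mono: "m \<le> k \<Longrightarrow> Bset k \<subseteq> Bset m"
  by (auto simp: Aset_def Bset_def)

lemma Aset_subset_iff: "Kclosed T \<Longrightarrow> Aset m \<subseteq> T \<longleftrightarrow> As m \<in> T"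
proof
  assume T: "Kclosed T" "As m \<in> T"
  have "As k \<in> T" if "m \<le> k" for k
    using that by (induction k rule: dec_induct) (use T in \<open>auto simp: Kclosed_def\<close>)
  then show "Aset m \<subseteq> T" by (auto simp: Aset_def)
qed auto

lemma Bset_subset_iff: "Kclosed T \<Longrightarrow> Bset m \<subseteq> T \<longleftrightarrow> Bs m \<in> T"
proof
  assume T: "Kclosed T" "Bs m \<in> T"
  have "Bs k \<in> T" if "m \<le> k" for k
    using that by (induction k rule: dec_induct) (use T in \<open>auto simp: Kclosed_def\<close>)
  then show "Bset m \<subseteq> T" by (auto simp: Bset_def)
qed auto

lemma Kcar_cases [consumes 1, case_names empty C A B D]:
  assumes "x \<in> Kcar"
  obtains "x = {}" | "x = {Cs}" | m where "x = Aset m" | n where "x = Bset n"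
    | m n where "x = {Cs} \<union> Aset m \<union> Bset n" "m \<le> n + 1" "n \<le> m + 1"
  using assms unfolding Kcar_def by blast

lemma Kcar_imp_Kclosed: "x \<in> Kcar \<Longrightarrow> Kclosed x"
  by (cases rule: Kcar_cases) (auto simp: Kclosed_def)

text \<open>Each nonempty trace of \<open>T\<close> on the \<open>As\<close> or the
  \<open>Bs\<close> symbols is a final segment starting at its least index. If both traces are
  nonempty, a common large index forces \<open>Cs\<close>, and the two crossing rules then keep the
  least indices at most one apart.\<close>

lemma Kclosed_imp_Kcar:
  assumes T: "Kclosed T"
  shows "T \<in> Kcar"
proof -
  have A: "T \<inter> range As = Aset (LEAST k. As k \<in> T)" if "As m \<in> T" for m
  proof -
    have "As (LEAST k. As k \<in> T) \<in> T" using that by (rule LeastI)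
    then have "Aset (LEAST k. As k \<in> T) \<subseteq> T" using Aset_subset_iff[OF T] by blast
    moreover have "(LEAST k. As k \<in> T) \<le> k" if "As k \<in> T" for k using that by (rule Least_le)
    ultimately show ?thesis by (auto simp: Aset_def)
  qed
  have B: "T \<inter> range Bs = Bset (LEAST k. Bs k \<in> T)" if "Bs m \<in> T" for m
  proof -
    have "Bs (LEAST k. Bs k \<in> T) \<in> T" using that by (rule LeastI)
    then have "Bset (LEAST k. Bs k \<in> T) \<subseteq> T" using Bset_subset_iff[OF T] by blast
    moreover have "(LEAST k. Bs k \<in> T) \<le> k" if "Bs k \<in> T" for k using that by (rule Least_le)
    ultimately show ?thesis by (auto simp: Bset_def)
  qed
  have univ: "s = Cs \<or> s \<in> range As \<or> s \<in> range Bs" for s by (cases s) auto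
  have T_eq: "T = (T \<inter> {Cs}) \<union> (T \<inter> range As) \<union> (T \<inter> range Bs)"
    using univ by blast
  consider (none) "\<forall>m. As m \<notin> T" "\<forall>n. Bs n \<notin> T"
    | (onlyA) m where "As m \<in> T" "\<forall>n. Bs n \<notin> T"
    | (onlyB) n where "Bs n \<in> T" "\<forall>m. As m \<notin> T"
    | (both) m n where "As m \<in> T" "Bs n \<in> T"
    by (cases "\<exists>m. As m \<in> T"; cases "\<exists>n. Bs n \<in> T") auto
  then show ?thesis
  proof cases
    case none
    then have "T \<subseteq> {Cs}" using univ by blast
    then have "T = {} \<or> T = {Cs}" by (simp add: subset_singleton_iff)
    then show ?thesis by (auto simp: Kcar_def)
  next
    case onlyA
    then have "Cs \<notin> T" using T by (auto simp: Kclosed_def)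
    moreover have "T \<inter> range Bs = {}" using onlyA by blast
    ultimately have "T = Aset (LEAST k. As k \<in> T)" using T_eq A[OF onlyA(1)] by simp
    then show ?thesis unfolding Kcar_def by blast
  next
    case onlyB
    then have "Cs \<notin> T" using T by (auto simp: Kclosed_def)
    moreover have "T \<inter> range As = {}" using onlyB by blast
    ultimately have "T = Bset (LEAST k. Bs k \<in> T)" using T_eq B[OF onlyB(1)] by simp
    then show ?thesis unfolding Kcar_def by blast
  next
    case both
    have "As (max m n) \<in> T" "Bs (max m n) \<in> T"
      using both Aset_subset_iff[OF T, of m] Bset_subset_iff[OF T, of n] by auto
    then have C: "Cs \<in> T" using T by (auto simp: Kclosed_def)
    define p q where "p = (LEAST k. As k \<in> T)" and "q = (LEAST k. Bs k \<in> T)"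
    have "As p \<in> T" "Bs q \<in> T"
      unfolding p_def q_def using both by (auto intro: LeastI)
    then have "As (Suc q) \<in> T" "Bs (Suc p) \<in> T" using C T by (auto simp: Kclosed_def)
    then have "p \<le> q + 1" "q \<le> p + 1" unfolding p_def q_def by (auto intro: Least_le)
    moreover have "T = {Cs} \<union> Aset p \<union> Bset q"
      using T_eq A[OF both(1)] B[OF both(2)] C unfolding p_def q_def by simp
    ultimately show ?thesis unfolding Kcar_def by blast
  qed
qed

lemma Kcar_iff_Kclosed: "x \<in> Kcar \<longleftrightarrow> Kclosed x"
  using Kcar_imp_Kclosed Kclosed_imp_Kcar by blast

lemma Kcar_intros [simp, intro]:
  "{} \<in> Kcar" "{Cs} \<in> Kcar" "Aset m \<in> Kcar" "Bset n \<in> Kcar"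
  "m \<le> n + 1 \<Longrightarrow> n \<le> m + 1 \<Longrightarrow> {Cs} \<union> Aset m \<union> Bset n \<in> Kcar"
  by (auto simp: Kcar_def)

section \<open>Meets and joins in \<open>K\<close>\<close>

lemma Kcar_Int [intro]: "x \<in> Kcar \<Longrightarrow> y \<in> Kcar \<Longrightarrow> x \<inter> y \<in> Kcar"
  by (auto simp: Kcar_iff_Kclosed Kclosed_def)

lemma Cs_in_Kcar: "x \<in> Kcar \<Longrightarrow> As m \<in> x \<Longrightarrow> Bs n \<in> x \<Longrightarrow> Cs \<in> x"
  by (cases rule: Kcar_cases) auto

text \<open>The closure rules survive arbitrary intersections. The empty family is included: its
  intersection \<open>UNIV\<close> is the top element of \<open>K\<close>.\<close>

lemma Kcar_Inter:
  assumes "\<forall>x\<in>X. x \<in> Kcar"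
  shows "\<Inter>X \<in> Kcar"
proof -
  have "\<forall>x\<in>X. Cs \<in> x" if "\<forall>x\<in>X. As m \<in> x" "\<forall>x\<in>X. Bs m \<in> x" for m
    using that assms Cs_in_Kcar by metis
  then show ?thesis
    using assms unfolding Kcar_iff_Kclosed Kclosed_def by simp
qed

text \<open>The members of \<open>K\<close> form a closure system, so the object described by
  \<open>THE\<close> exists: it is the closure of the union.\<close>

lemma Kjoin_eq_Inter: "Kjoin x y = \<Inter>{z \<in> Kcar. x \<union> y \<subseteq> z}"
  unfolding Kjoin_def
proof (rule the_equality)
  show "\<Inter>{z \<in> Kcar. x \<union> y \<subseteq> z} \<in> Kcar \<and> x \<union> y \<subseteq> \<Inter>{z \<in> Kcar. x \<union> y \<subseteq> z} \<and>
      (\<forall>w\<in>Kcar. x \<union> y \<subseteq> w \<longrightarrow> \<Inter>{z \<in> Kcar. x \<union> y \<subseteq> z} \<subseteq> w)"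
    using Kcar_Inter[of "{z \<in> Kcar. x \<union> y \<subseteq> z}"] by auto
next
  fix z
  assume z: "z \<in> Kcar \<and> x \<union> y \<subseteq> z \<and> (\<forall>w\<in>Kcar. x \<union> y \<subseteq> w \<longrightarrow> z \<subseteq> w)"
  then have "\<Inter>{z \<in> Kcar. x \<union> y \<subseteq> z} \<subseteq> z" by (intro Inter_lower) simp
  moreover have "z \<subseteq> \<Inter>{z \<in> Kcar. x \<union> y \<subseteq> z}" using z by (intro Inter_greatest) simp
  ultimately show "z = \<Inter>{z \<in> Kcar. x \<union> y \<subseteq> z}" by (rule subset_antisym[rotated])
qed

lemma Kjoin_in_Kcar [simp, intro]: "Kjoin x y \<in> Kcar"
  unfolding Kjoin_eq_Inter by (rule Kcar_Inter) simp

lemma Kjoin_upper1: "x \<subseteq> Kjoin x y" and Kjoin_upper2: "y \<subseteq> Kjoin x y"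
  by (auto simp: Kjoin_eq_Inter)

lemma Kjoin_subset_iff: "z \<in> Kcar \<Longrightarrow> Kjoin x y \<subseteq> z \<longleftrightarrow> x \<subseteq> z \<and> y \<subseteq> z"
  unfolding Kjoin_eq_Inter by blast

lemma Kjoin_eq_Un: "x \<union> y \<in> Kcar \<Longrightarrow> Kjoin x y = x \<union> y"
  by (simp add: Kjoin_subset_iff Kjoin_upper1 Kjoin_upper2 subset_antisym)

lemma Kjoin_absorb1: "x \<in> Kcar \<Longrightarrow> y \<subseteq> x \<Longrightarrow> Kjoin x y = x"
  by (simp add: Kjoin_eq_Un Un_absorb2)

lemma jle_Kjoin_iff: "x \<in> Kcar \<Longrightarrow> y \<in> Kcar \<Longrightarrow> jle Kjoin x y \<longleftrightarrow> x \<subseteq> y"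
  unfolding jle_def using Kjoin_upper1[of x y] Kjoin_eq_Un[of x y] by (auto simp: Un_absorb1)

text \<open>The rule from \<open>Cs\<close> and \<open>As m\<close> to \<open>Bs (Suc m)\<close>
  forces the extra chain. Nothing further is added, since indices one apart already give a member of
  \<open>K\<close>.\<close>

lemma Kjoin_Cs_Aset: "Kjoin {Cs} (Aset m) = {Cs} \<union> Aset m \<union> Bset (Suc m)"
proof
  have K: "Kclosed (Kjoin {Cs} (Aset m))" by (simp flip: Kcar_iff_Kclosed)
  moreover have "Cs \<in> Kjoin {Cs} (Aset m)" "Aset m \<subseteq> Kjoin {Cs} (Aset m)"
    using Kjoin_upper1 Kjoin_upper2 by blast+
  moreover from this have "Bs (Suc m) \<in> Kjoin {Cs} (Aset m)"
    using K unfolding Aset_subset_iff[OF K] by (auto simp: Kclosed_def)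
  ultimately show "{Cs} \<union> Aset m \<union> Bset (Suc m) \<subseteq> Kjoin {Cs} (Aset m)"
    by (simp add: Bset_subset_iff)
qed (intro Kjoin_subset_iff[THEN iffD2] conjI Kcar_intros; auto)

lemma Kjoin_Cs_Bset: "Kjoin {Cs} (Bset n) = {Cs} \<union> Aset (Suc n) \<union> Bset n"
proof
  have K: "Kclosed (Kjoin {Cs} (Bset n))" by (simp flip: Kcar_iff_Kclosed)
  moreover have "Cs \<in> Kjoin {Cs} (Bset n)" "Bset n \<subseteq> Kjoin {Cs} (Bset n)"
    using Kjoin_upper1 Kjoin_upper2 by blast+
  moreover from this have "As (Suc n) \<in> Kjoin {Cs} (Bset n)"
    using K unfolding Bset_subset_iff[OF K] by (auto simp: Kclosed_def)
  ultimately show "{Cs} \<union> Aset (Suc n) \<union> Bset n \<subseteq> Kjoin {Cs} (Bset n)"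
    by (simp add: Aset_subset_iff)
qed (intro Kjoin_subset_iff[THEN iffD2] conjI Kcar_intros; auto)

lemma Kjoin_Aset_Bset:
  assumes "m \<le> n + 1" "n \<le> m + 1"
  shows "Kjoin (Aset m) (Bset n) = {Cs} \<union> Aset m \<union> Bset n"
proof
  have "Aset m \<subseteq> Kjoin (Aset m) (Bset n)" "Bset n \<subseteq> Kjoin (Aset m) (Bset n)"
    by (rule Kjoin_upper1, rule Kjoin_upper2)
  moreover from this have "Cs \<in> Kjoin (Aset m) (Bset n)"
    using Cs_in_Kcar[OF Kjoin_in_Kcar, of m _ _ n] mem_Aset(1)[of m m] mem_Bset(1)[of n n] by blast
  ultimately show "{Cs} \<union> Aset m \<union> Bset n \<subseteq> Kjoin (Aset m) (Bset n)" by blast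
qed (use assms in \<open>intro Kjoin_subset_iff[THEN iffD2] conjI Kcar_intros; auto\<close>)

section \<open>K is infinite, generated by three elements and 2-modular\<close>

lemma infinite_Kcar: "infinite Kcar"
proof -
  have "inj Aset"
    by (rule injI) (metis mem_Aset(1) order_antisym order_refl)
  then have "infinite (range Aset)" using finite_imageD infinite_UNIV_nat by blast
  moreover have "range Aset \<subseteq> Kcar" by auto
  ultimately show ?thesis by (rule infinite_super[rotated])
qed

text \<open>The generators are \<open>{Cs}\<close> and the two full chains. Joining
  \<open>Bset m\<close> with \<open>{Cs}\<close> brings in \<open>Aset (Suc m)\<close>, which the
  meet with \<open>Aset 0\<close> extracts, and symmetrically; so both chains arise by one joint
  induction. The remaining members are meets and joins of these.\<close>

lemma generated_by_three_Kcar: "generated_by_three Kcar Kjoin Kmeet"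
proof -
  let ?G = "gen_sublattice Kcar Kjoin Kmeet {{Cs}, Aset 0, Bset 0}"
  have "x \<in> Kcar" if "x \<in> ?G" for x
    using that by induction (auto simp: Kmeet_def)
  moreover have "x \<in> ?G" if "x \<in> Kcar" for x
  proof -
    have C: "{Cs} \<in> ?G" and A0: "Aset 0 \<in> ?G" and B0: "Bset 0 \<in> ?G"
      by (auto intro: gen_base)
    have AB: "Aset m \<in> ?G \<and> Bset m \<in> ?G" for m
    proof (induction m)
      case (Suc m)
      have "Kmeet (Kjoin {Cs} (Bset m)) (Aset 0) \<in> ?G" "Kmeet (Kjoin {Cs} (Aset m)) (Bset 0) \<in> ?G"
        using Suc C A0 B0 by (auto intro: gen_join gen_meet)
      moreover have "Kmeet (Kjoin {Cs} (Bset m)) (Aset 0) = Aset (Suc m)"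
        "Kmeet (Kjoin {Cs} (Aset m)) (Bset 0) = Bset (Suc m)"
        unfolding Kmeet_def Kjoin_Cs_Aset Kjoin_Cs_Bset by (auto simp: Aset_def Bset_def)
      ultimately show ?case by simp
    qed (use A0 B0 in simp)
    from \<open>x \<in> Kcar\<close> show ?thesis
    proof (cases rule: Kcar_cases)
      case empty
      have "Kmeet (Aset 0) (Bset 0) \<in> ?G" using A0 B0 by (rule gen_meet)
      moreover have "Kmeet (Aset 0) (Bset 0) = {}" by (auto simp: Kmeet_def Aset_def)
      ultimately show ?thesis using empty by simp
    next
      case (D m n)
      then show ?thesis using AB gen_join by (metis Kjoin_Aset_Bset)
    qed (use AB C in auto)
  qed
  ultimately have "?G = Kcar" by blast
  then show ?thesis unfolding generated_by_three_def by blast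
qed

text \<open>With a commutative meet, \<open>hstep\<close> commutes with permuting the entries.
  Together with the next transposition this allows arguments up to the order of the triple.\<close>

lemma hstep_stable_swap12:
  assumes "\<And>x y. mt x y = mt y x"
    and "(hstep jn mt ^^ Suc h) (y, x, z) = (hstep jn mt ^^ h) (y, x, z)"
  shows "(hstep jn mt ^^ Suc h) (x, y, z) = (hstep jn mt ^^ h) (x, y, z)"
proof -
  let ?s = "\<lambda>(x, y, z). (y, x, z)"
  have "hstep jn mt (?s u) = ?s (hstep jn mt u)" for u
    using assms(1) by (auto simp: hstep_def split: prod.splits)
  then have "(hstep jn mt ^^ k) (?s u) = ?s ((hstep jn mt ^^ k) u)" for k u
    by (induction k) auto
  from this[of _ "(y, x, z)"] show ?thesis using assms(2) by (simp del: funpow.simps)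
qed

lemma hstep_stable_swap23:
  assumes "\<And>x y. mt x y = mt y x"
    and "(hstep jn mt ^^ Suc h) (x, z, y) = (hstep jn mt ^^ h) (x, z, y)"
  shows "(hstep jn mt ^^ Suc h) (x, y, z) = (hstep jn mt ^^ h) (x, y, z)"
proof -
  let ?s = "\<lambda>(x, y, z). (x, z, y)"
  have "hstep jn mt (?s u) = ?s (hstep jn mt u)" for u
    using assms(1) by (auto simp: hstep_def split: prod.splits)
  then have "(hstep jn mt ^^ k) (?s u) = ?s ((hstep jn mt ^^ k) u)" for k u
    by (induction k) auto
  from this[of _ "(x, z, y)"] show ?thesis using assms(2) by (simp del: funpow.simps)
qed

section \<open>Stability of triples in \<open>K\<close> after two steps\<close>

abbreviation Kstable :: "ksym set \<Rightarrow> ksym set \<Rightarrow> ksym set \<Rightarrow> bool" where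
  "Kstable x y z \<equiv>
     (hstep Kjoin Kmeet ^^ Suc 2) (x, y, z) = (hstep Kjoin Kmeet ^^ 2) (x, y, z)"

lemma Kstable_swap12: "Kstable y x z \<Longrightarrow> Kstable x y z"
  by (rule hstep_stable_swap12) (auto simp: Kmeet_def)

lemma Kstable_swap23: "Kstable x z y \<Longrightarrow> Kstable x y z"
  by (rule hstep_stable_swap23) (auto simp: Kmeet_def)

text \<open>The entry \<open>y\<close> never moves. The first entry becomes the join of
  \<open>x\<close> with \<open>y \<inter> z\<close>, then the meet of \<open>y\<close> with the join
  of \<open>z\<close> and \<open>x\<close>: these are the two sides of the modular law, and
  afterwards nothing changes.\<close>

lemma Kstable_comparable:
  assumes K: "x \<in> Kcar" "y \<in> Kcar" "z \<in> Kcar" and "x \<subseteq> y"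
  shows "Kstable x y z"
proof -
  let ?x1 = "Kjoin x (y \<inter> z)" and ?z1 = "Kjoin z x"
  have x1: "?x1 \<subseteq> y" using K \<open>x \<subseteq> y\<close> by (simp add: Kjoin_subset_iff)
  have "?x1 \<subseteq> ?z1"
    using Kjoin_upper1[of z x] Kjoin_upper2[of x z] by (auto simp: Kjoin_subset_iff)
  with x1 K have x2: "Kjoin ?x1 (y \<inter> ?z1) = y \<inter> ?z1"
    by (simp add: Kcar_Int Kjoin_eq_Un Un_absorb1)
  have s1: "hstep Kjoin Kmeet (x, y, z) = (?x1, y, ?z1)"
    using K \<open>x \<subseteq> y\<close> by (simp add: hstep_def Kmeet_def Kjoin_absorb1 Int_absorb2 le_infI1)
  have s2: "hstep Kjoin Kmeet (?x1, y, ?z1) = (y \<inter> ?z1, y, ?z1)"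
    using K x1 \<open>?x1 \<subseteq> ?z1\<close> by (simp add: hstep_def Kmeet_def x2 Kjoin_absorb1 le_infI1)
  have s3: "hstep Kjoin Kmeet (y \<inter> ?z1, y, ?z1) = (y \<inter> ?z1, y, ?z1)"
    using K by (simp add: hstep_def Kmeet_def Kjoin_absorb1 Kcar_Int le_infI1)
  show ?thesis by (simp add: numeral_2_eq_2 s1 s2 s3)
qed

text \<open>Once \<open>Cs\<close> is present, every rule has at most one further premise, so unions
  of closed sets are closed.\<close>

lemma Kjoin_Cs: "x \<in> Kcar \<Longrightarrow> y \<in> Kcar \<Longrightarrow> Cs \<in> x \<Longrightarrow> Cs \<in> y \<Longrightarrow> Kjoin x y = x \<union> y"
  by (rule Kjoin_eq_Un) (auto simp: Kcar_iff_Kclosed Kclosed_def)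

text \<open>After the first step all entries contain \<open>Cs\<close>, where join is union and meet
  is intersection. By distributivity the second step already reaches a fixed triple.\<close>

lemma Kstable_if_Cs_step:
  assumes "hstep Kjoin Kmeet (x, y, z) = (x1, y1, z1)"
    and "x1 \<in> Kcar" "y1 \<in> Kcar" "z1 \<in> Kcar" "Cs \<in> x1" "Cs \<in> y1" "Cs \<in> z1"
  shows "Kstable x y z"
proof -
  have "hstep Kjoin Kmeet (x', y', z') = (x' \<union> (y' \<inter> z'), y' \<union> (x' \<inter> z'), z' \<union> (x' \<inter> y'))"
    if "x' \<in> Kcar" "y' \<in> Kcar" "z' \<in> Kcar" "Cs \<in> x'" "Cs \<in> y'" "Cs \<in> z'" for x' y' z'
    using that by (simp add: hstep_def Kmeet_def Kjoin_Cs Kcar_Int)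
  moreover have "x' \<union> y' \<in> Kcar" if "x' \<in> Kcar" "y' \<in> Kcar" "Cs \<in> x'" "Cs \<in> y'" for x' y'
    using that by (metis Kjoin_Cs Kjoin_in_Kcar)
  ultimately show ?thesis
    using assms by (simp add: numeral_2_eq_2 Kcar_Int) blast
qed

lemma Kstable_two_Cs:
  assumes "x \<in> Kcar" "y \<in> Kcar" "z \<in> Kcar" "Cs \<in> x" "Cs \<in> y"
  shows "Kstable x y z"
proof (rule Kstable_if_Cs_step)
  show "hstep Kjoin Kmeet (x, y, z) = (Kjoin x (y \<inter> z), Kjoin y (x \<inter> z), Kjoin z (x \<inter> y))"
    by (simp add: hstep_def Kmeet_def)
  show "Cs \<in> Kjoin x (y \<inter> z)" "Cs \<in> Kjoin y (x \<inter> z)" using assms Kjoin_upper1 by blast+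
  show "Cs \<in> Kjoin z (x \<inter> y)" using assms Kjoin_upper2 by blast
qed simp_all

lemma Kstable_Aset_Bset:
  assumes "x \<in> Kcar"
  shows "Kstable x (Aset m) (Bset n)"
proof -
  have [simp]: "Aset i \<inter> Bset j = {}" for i j by (auto simp: Aset_def)
  from assms show ?thesis
  proof (cases rule: Kcar_cases)
    case empty
    show ?thesis unfolding empty by (rule Kstable_comparable) auto
  next
    \<comment> \<open>All pairwise meets are empty, so the triple is fixed from the start.\<close>
    case C
    then have "hstep Kjoin Kmeet (x, Aset m, Bset n) = (x, Aset m, Bset n)"
      by (simp add: hstep_def Kmeet_def Kjoin_absorb1)
    then show ?thesis by (simp add: numeral_2_eq_2)
  next
    case (A k)
    then have "x \<subseteq> Aset m \<or> Aset m \<subseteq> x" by (auto simp: Aset_def)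
    then show ?thesis using A Kstable_comparable Kstable_swap12 by auto
  next
    case (B k)
    then have "x \<subseteq> Bset n \<or> Bset n \<subseteq> x" by (auto simp: Bset_def)
    then have "Kstable x (Bset n) (Aset m)"
      using B Kstable_comparable[of x "Bset n" "Aset m"] Kstable_comparable[of "Bset n" x "Aset m"]
        Kstable_swap12[of "Bset n" x "Aset m"] by auto
    then show ?thesis by (rule Kstable_swap23)
  next
    \<comment> \<open>Since \<open>x\<close> meets both chains, one step gives each chain a symbol
      of the other, hence also \<open>Cs\<close>; \<open>x\<close> itself stays.\<close>
    case (D p q)
    show ?thesis
    proof (rule Kstable_if_Cs_step)
      show "hstep Kjoin Kmeet (x, Aset m, Bset n) =
          (x, Kjoin (Aset m) (x \<inter> Bset n), Kjoin (Bset n) (x \<inter> Aset m))"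
        using assms by (simp add: hstep_def Kmeet_def Kjoin_absorb1)
      have "As m \<in> Aset m" "Bs (max q n) \<in> x \<inter> Bset n" using D by auto
      then have "As m \<in> Kjoin (Aset m) (x \<inter> Bset n)" "Bs (max q n) \<in> Kjoin (Aset m) (x \<inter> Bset n)"
        using Kjoin_upper1[of "Aset m" "x \<inter> Bset n"] Kjoin_upper2[of "x \<inter> Bset n" "Aset m"] by blast+
      then show "Cs \<in> Kjoin (Aset m) (x \<inter> Bset n)" by (rule Cs_in_Kcar[OF Kjoin_in_Kcar])
      have "As (max p m) \<in> x \<inter> Aset m" "Bs n \<in> Bset n" using D by auto
      then have "As (max p m) \<in> Kjoin (Bset n) (x \<inter> Aset m)" "Bs n \<in> Kjoin (Bset n) (x \<inter> Aset m)"
        using Kjoin_upper1[of "Bset n" "x \<inter> Aset m"] Kjoin_upper2[of "x \<inter> Aset m" "Bset n"] by blast+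
      then show "Cs \<in> Kjoin (Bset n) (x \<inter> Aset m)" by (rule Cs_in_Kcar[OF Kjoin_in_Kcar])
    qed (use assms D in auto)
  qed
qed

text \<open>Without \<open>Cs\<close> a member is empty or lies on one of the two chains, so
  incomparable \<open>y\<close> and \<open>z\<close> are one of each kind.\<close>

lemma Kstable_two_no_Cs:
  assumes K: "x \<in> Kcar" "y \<in> Kcar" "z \<in> Kcar" and "Cs \<notin> y" "Cs \<notin> z"
  shows "Kstable x y z"
proof (cases "y \<subseteq> z \<or> z \<subseteq> y")
  case True
  then have "Kstable y z x" using K Kstable_comparable Kstable_swap12 by metis
  then show ?thesis using Kstable_swap12 Kstable_swap23 by metis
next
  case False
  have "Aset i \<subseteq> Aset j \<or> Aset j \<subseteq> Aset i" "Bset i \<subseteq> Bset j \<or> Bset j \<subseteq> Bset i" for i j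
    by (auto simp: Aset_def Bset_def)
  with False consider (AB) m n where "y = Aset m" "z = Bset n" | (BA) m n where "y = Bset n" "z = Aset m"
    using \<open>Cs \<notin> y\<close> \<open>Cs \<notin> z\<close>
    by (cases rule: Kcar_cases[OF K(2)]; cases rule: Kcar_cases[OF K(3)]) auto
  then show ?thesis
    using K(1) Kstable_Aset_Bset Kstable_swap23 by cases auto
qed

lemma h_modular_Kcar: "h_modular 2 Kcar Kjoin Kmeet"
proof -
  have "Kstable x y z" if "x \<in> Kcar" "y \<in> Kcar" "z \<in> Kcar" for x y z
  proof -
    \<comment> \<open>Pigeonhole: two of the three entries agree on containing
      \<open>Cs\<close>.\<close>
    consider "Cs \<in> x \<longleftrightarrow> Cs \<in> y" | "Cs \<in> x \<longleftrightarrow> Cs \<in> z" | "Cs \<in> y \<longleftrightarrow> Cs \<in> z" by blast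
    then show ?thesis
      using that Kstable_two_Cs Kstable_two_no_Cs Kstable_swap12 Kstable_swap23 by cases metis+
  qed
  then show ?thesis unfolding h_modular_def Suc_eq_plus1 by blast
qed

section \<open>Compact bi-ideals\<close>

lemma biideal_closure_least:
  "biideal SA jA zA SB jB zB J \<Longrightarrow> X \<subseteq> J \<Longrightarrow> biideal_closure SA jA zA SB jB zB X \<subseteq> J"
  by (auto simp: biideal_closure_def)

lemma biideal_carrierD: "biideal SA jA zA SB jB zB I \<Longrightarrow> I \<subseteq> SA \<times> SB"
  unfolding biideal_def by (elim conjE)

lemma biideal_downD:
  assumes "biideal SA jA zA SB jB zB I" "(a, b) \<in> I" "a' \<in> SA" "b' \<in> SB" "jle jA a' a" "jle jB b' b"
  shows "(a', b') \<in> I"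
proof -
  have "\<forall>a b a' b'. (a, b) \<in> I \<and> a' \<in> SA \<and> b' \<in> SB \<and> jle jA a' a \<and> jle jB b' b \<longrightarrow> (a', b') \<in> I"
    using assms(1) unfolding biideal_def by (elim conjE)
  from this[rule_format, of a b a' b'] show ?thesis using assms(2-) by simp
qed

lemma biideal_join1D:
  "biideal SA jA zA SB jB zB I \<Longrightarrow> (a, b) \<in> I \<Longrightarrow> (a', b) \<in> I \<Longrightarrow> (jA a a', b) \<in> I"
  unfolding biideal_def by simp

lemma biideal_join2D:
  "biideal SA jA zA SB jB zB I \<Longrightarrow> (a, b) \<in> I \<Longrightarrow> (a, b') \<in> I \<Longrightarrow> (a, jB b b') \<in> I"
  unfolding biideal_def by simp

lemma biideal_zeroD:
  assumes "biideal SA jA zA SB jB zB I"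
  shows "a \<in> SA \<Longrightarrow> (a, zB) \<in> I" "b \<in> SB \<Longrightarrow> (zA, b) \<in> I"
  using assms unfolding biideal_def by auto

lemma in_biideal_closureI:
  "(\<And>J. biideal SA jA zA SB jB zB J \<Longrightarrow> X \<subseteq> J \<Longrightarrow> p \<in> J) \<Longrightarrow> p \<in> biideal_closure SA jA zA SB jB zB X"
  by (auto simp: biideal_closure_def)

text \<open>A bi-ideal \<open>I\<close> above \<open>X\<close> makes the intersected family
  nonempty, which keeps the closure inside \<open>SA \<times> SB\<close>.\<close>

lemma biideal_biideal_closure:
  assumes "biideal SA jA zA SB jB zB I" "X \<subseteq> I"
  shows "biideal SA jA zA SB jB zB (biideal_closure SA jA zA SB jB zB X)"
proof -
  let ?B = "biideal SA jA zA SB jB zB" and ?C = "biideal_closure SA jA zA SB jB zB X"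
  have least: "?C \<subseteq> J" if "?B J" "X \<subseteq> J" for J
    using that by (rule biideal_closure_least)
  have "?C \<subseteq> SA \<times> SB"
    by (rule subset_trans[OF least[OF assms] biideal_carrierD[OF assms(1)]])
  moreover have "(a', b') \<in> ?C"
    if "(a, b) \<in> ?C" "a' \<in> SA" "b' \<in> SB" "jle jA a' a" "jle jB b' b" for a b a' b'
  proof (rule in_biideal_closureI)
    fix J assume J: "?B J" "X \<subseteq> J"
    show "(a', b') \<in> J"
      by (rule biideal_downD[OF J(1) subsetD[OF least[OF J] that(1)] that(2-)])
  qed
  moreover have "SA \<times> {zB} \<union> {zA} \<times> SB \<subseteq> ?C"
    by (intro subsetI in_biideal_closureI) (auto intro: biideal_zeroD)
  moreover have "(a, jB b0 b1) \<in> ?C" if "(a, b0) \<in> ?C" "(a, b1) \<in> ?C" for a b0 b1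
  proof (rule in_biideal_closureI)
    fix J assume J: "?B J" "X \<subseteq> J"
    show "(a, jB b0 b1) \<in> J"
      by (intro biideal_join2D[OF J(1)] subsetD[OF least[OF J]] that)
  qed
  moreover have "(jA a0 a1, b) \<in> ?C" if "(a0, b) \<in> ?C" "(a1, b) \<in> ?C" for a0 a1 b
  proof (rule in_biideal_closureI)
    fix J assume J: "?B J" "X \<subseteq> J"
    show "(jA a0 a1, b) \<in> J"
      by (intro biideal_join1D[OF J(1)] subsetD[OF least[OF J]] that)
  qed
  ultimately show ?thesis unfolding biideal_def[of _ _ _ _ _ _ ?C] by (intro conjI allI impI) auto
qed

text \<open>Compactness is applied to the covering of \<open>I\<close> by the closures of its single
  pairs; the pairs behind a finite subcover generate \<open>I\<close>.\<close>

lemma tensor_elem_finitely_generated: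
  assumes "tensor_elem SA jA zA SB jB zB I"
  obtains P where "finite P" "P \<subseteq> I"
    "\<forall>J. biideal SA jA zA SB jB zB J \<longrightarrow> P \<subseteq> J \<longrightarrow> I \<subseteq> J"
proof -
  let ?cl = "biideal_closure SA jA zA SB jB zB"
  have I: "biideal SA jA zA SB jB zB I" using assms by (simp add: tensor_elem_def)
  let ?F = "(\<lambda>p. ?cl {p}) ` I"
  have self: "X \<subseteq> ?cl X" for X by (auto simp: biideal_closure_def)
  have "\<forall>J\<in>?F. biideal SA jA zA SB jB zB J"
    using biideal_biideal_closure[OF I] by auto
  moreover have "p \<in> \<Union>?F" if "p \<in> I" for p
    using that self[of "{p}"] by auto
  then have "I \<subseteq> ?cl (\<Union>?F)" using self[of "\<Union>?F"] by blast
  ultimately have "\<exists>G\<subseteq>?F. finite G \<and> I \<subseteq> ?cl (\<Union>G)"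
    using assms unfolding tensor_elem_def by blast
  then obtain G where G: "G \<subseteq> ?F" "finite G" "I \<subseteq> ?cl (\<Union>G)" by blast
  from finite_subset_image[OF G(2,1)] obtain P
    where P: "P \<subseteq> I" "finite P" and G_eq: "G = (\<lambda>p. ?cl {p}) ` P" by blast
  have "I \<subseteq> J" if J: "biideal SA jA zA SB jB zB J" "P \<subseteq> J" for J
  proof -
    have "?cl {p} \<subseteq> J" if "p \<in> P" for p
      using that J(2) by (intro biideal_closure_least[OF J(1)]) auto
    then have "?cl (\<Union>G) \<subseteq> J"
      unfolding G_eq by (intro biideal_closure_least[OF J(1)]) auto
    with G(3) show ?thesis by (rule subset_trans)
  qed
  with P show ?thesis by (intro that allI impI)
qed

text \<open>Inserting \<open>bot\<close> keeps the argument of \<open>Sup_fin\<close> nonempty, and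
  the zero condition of a bi-ideal settles the empty \<open>Y\<close>.\<close>

lemma Sup_fin_in_section:
  assumes "biideal SA jA zA UNIV (sup :: 'b::bounded_lattice_bot \<Rightarrow> _) bot I" "x \<in> SA" "finite Y"
    and "\<forall>y\<in>Y. (x, y) \<in> I"
  shows "(x, Sup_fin (insert bot Y)) \<in> I"
  using assms(3,4)
proof (induction Y rule: finite_induct)
  case empty
  then show ?case using assms(1,2) unfolding biideal_def by auto
next
  case (insert y Y)
  then have "(x, y) \<in> I" "(x, Sup_fin (insert bot Y)) \<in> I" by auto
  moreover have "Sup_fin (insert bot (insert y Y)) = sup y (Sup_fin (insert bot Y))"
    using insert.hyps by (simp add: insert_commute[of bot y] Sup_fin.insert)
  ultimately show ?case using assms(1) unfolding biideal_def by auto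
qed

section \<open>Bi-ideals of K and L as functions on symbols\<close>

abbreviation Kbiideal :: "(ksym set \<times> 'b::bounded_lattice_bot) set \<Rightarrow> bool" where
  "Kbiideal \<equiv> biideal Kcar Kjoin {} UNIV sup bot"

lemma jle_sup_iff: "jle sup a (b :: 'b::semilattice_sup) \<longleftrightarrow> a \<le> b"
  by (simp add: jle_def le_iff_sup)

lemma Kbiideal_in_Kcar: "Kbiideal I \<Longrightarrow> (x, y) \<in> I \<Longrightarrow> x \<in> Kcar"
  using biideal_carrierD[of Kcar Kjoin "{}" UNIV sup bot I] by auto

lemma Kbiideal_down:
  "Kbiideal I \<Longrightarrow> (x, y) \<in> I \<Longrightarrow> x' \<in> Kcar \<Longrightarrow> x' \<subseteq> x \<Longrightarrow> y' \<le> y \<Longrightarrow> (x', y') \<in> I"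
  using biideal_downD[of Kcar Kjoin "{}" UNIV sup bot I x y x' y'] Kbiideal_in_Kcar[of I x y]
  by (simp add: jle_Kjoin_iff jle_sup_iff)

lemma Kbiideal_sup: "Kbiideal I \<Longrightarrow> (x, y) \<in> I \<Longrightarrow> (x, y') \<in> I \<Longrightarrow> (x, sup y y') \<in> I"
  by (rule biideal_join2D)

lemma Kbiideal_Kjoin: "Kbiideal I \<Longrightarrow> (x, y) \<in> I \<Longrightarrow> (x', y) \<in> I \<Longrightarrow> (Kjoin x x', y) \<in> I"
  by (rule biideal_join1D)

lemma Kbiideal_bot: "Kbiideal I \<Longrightarrow> x \<in> Kcar \<Longrightarrow> (x, bot) \<in> I"
  by (simp add: biideal_zeroD)

lemma Kbiideal_empty: "Kbiideal I \<Longrightarrow> ({}, y) \<in> I"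
  by (simp add: biideal_zeroD)

section \<open>The closure rules inside a bi-ideal\<close>

lemma Kbiideal_Aset_mono: "Kbiideal I \<Longrightarrow> (Aset m, y) \<in> I \<Longrightarrow> m \<le> k \<Longrightarrow> (Aset k, y) \<in> I"
  by (rule Kbiideal_down[of I "Aset m" y]) (simp_all add: Aset_mono)

lemma Kbiideal_Bset_mono: "Kbiideal I \<Longrightarrow> (Bset m, y) \<in> I \<Longrightarrow> m \<le> k \<Longrightarrow> (Bset k, y) \<in> I"
  by (rule Kbiideal_down[of I "Bset m" y]) (simp_all add: Bset_mono)

text \<open>Lowering both second coordinates to \<open>inf c a\<close> permits a lateral join, whose
  first coordinate contains \<open>Bset (Suc m)\<close>. The next two lemmas treat the other binary
  rules in the same way.\<close>

lemma Kbiideal_Bset_Suc: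
  assumes "Kbiideal I" "({Cs}, c) \<in> I" "(Aset m, a) \<in> I"
  shows "(Bset (Suc m), inf c a) \<in> I"
proof -
  have "({Cs}, inf c a) \<in> I" "(Aset m, inf c a) \<in> I"
    using assms by (auto intro: Kbiideal_down)
  then have "(Kjoin {Cs} (Aset m), inf c a) \<in> I" by (rule Kbiideal_Kjoin[OF assms(1)])
  then show ?thesis by (rule Kbiideal_down[OF assms(1)]) (auto simp: Kjoin_Cs_Aset)
qed

lemma Kbiideal_Aset_Suc:
  assumes "Kbiideal I" "({Cs}, c) \<in> I" "(Bset m, b) \<in> I"
  shows "(Aset (Suc m), inf c b) \<in> I"
proof -
  have "({Cs}, inf c b) \<in> I" "(Bset m, inf c b) \<in> I"
    using assms by (auto intro: Kbiideal_down)
  then have "(Kjoin {Cs} (Bset m), inf c b) \<in> I" by (rule Kbiideal_Kjoin[OF assms(1)])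
  then show ?thesis by (rule Kbiideal_down[OF assms(1)]) (auto simp: Kjoin_Cs_Bset)
qed

lemma Kbiideal_Cs:
  assumes "Kbiideal I" "(Aset m, a) \<in> I" "(Bset m, b) \<in> I"
  shows "({Cs}, inf a b) \<in> I"
proof -
  have "(Aset m, inf a b) \<in> I" "(Bset m, inf a b) \<in> I"
    using assms by (auto intro: Kbiideal_down)
  then have "(Kjoin (Aset m) (Bset m), inf a b) \<in> I" by (rule Kbiideal_Kjoin[OF assms(1)])
  then show ?thesis by (rule Kbiideal_down[OF assms(1)]) (auto simp: Kjoin_Aset_Bset)
qed

text \<open>The least member of \<open>K\<close> containing the symbol. Every nonempty member is a
  join of at most two of these.\<close>

fun principal :: "ksym \<Rightarrow> ksym set" where
  "principal Cs = {Cs}"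
| "principal (As m) = Aset m"
| "principal (Bs m) = Bset m"

lemma principal_in_Kcar [simp]: "principal s \<in> Kcar"
  by (cases s) auto

lemma principal_subset: "x \<in> Kcar \<Longrightarrow> s \<in> x \<Longrightarrow> principal s \<subseteq> x"
  by (cases s) (auto simp: Kcar_iff_Kclosed dest: Aset_subset_iff Bset_subset_iff)

definition biideal_of :: "(ksym \<Rightarrow> 'b::bounded_lattice_bot) \<Rightarrow> (ksym set \<times> 'b) set" where
  "biideal_of f = {(x, y). x \<in> Kcar \<and> (\<forall>s\<in>x. y \<le> f s)}"

text \<open>Equivalently, every level set \<open>{s. y \<le> f s}\<close> belongs to
  \<open>K\<close>.\<close>

definition rule_monotone :: "(ksym \<Rightarrow> 'b::lattice) \<Rightarrow> bool" where
  "rule_monotone f \<longleftrightarrow>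
     (\<forall>m. f (As m) \<le> f (As (Suc m))) \<and>
     (\<forall>m. f (Bs m) \<le> f (Bs (Suc m))) \<and>
     (\<forall>m. inf (f (As m)) (f (Bs m)) \<le> f Cs) \<and>
     (\<forall>m. inf (f Cs) (f (As m)) \<le> f (Bs (Suc m))) \<and>
     (\<forall>m. inf (f Cs) (f (Bs m)) \<le> f (As (Suc m)))"

lemma rule_monotone_mono:
  assumes "rule_monotone f" "m \<le> k"
  shows "f (As m) \<le> f (As k)" "f (Bs m) \<le> f (Bs k)"
  using assms lift_Suc_mono_le[of "\<lambda>m. f (As m)" m k] lift_Suc_mono_le[of "\<lambda>m. f (Bs m)" m k]
  unfolding rule_monotone_def by blast+

lemma rule_monotone_Cs:
  assumes "rule_monotone f"
  shows "inf (f (As m)) (f (Bs n)) \<le> f Cs"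
proof -
  have "inf (f (As m)) (f (Bs n)) \<le> inf (f (As (max m n))) (f (Bs (max m n)))"
    using rule_monotone_mono[OF assms] by (intro inf_mono) simp_all
  also have "\<dots> \<le> f Cs" using assms unfolding rule_monotone_def by blast
  finally show ?thesis .
qed

lemma principal_in_biideal_of:
  assumes "rule_monotone f"
  shows "(principal s, f s) \<in> biideal_of f"
proof -
  have "f s \<le> f t" if "t \<in> principal s" for t
    using that rule_monotone_mono[OF assms] by (cases s; cases t) auto
  then show ?thesis by (simp add: biideal_of_def)
qed

text \<open>Lateral joins in the first coordinate are the only real issue: a level set of
  \<open>f\<close> is a member of \<open>K\<close>, so it contains the join of any two sets that it
  contains.\<close>

lemma Kbiideal_biideal_of:
  assumes f: "rule_monotone f"
  shows "Kbiideal (biideal_of f)"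
proof -
  have "{s. y \<le> f s} \<in> Kcar" for y
    using f unfolding Kcar_iff_Kclosed Kclosed_def rule_monotone_def mem_Collect_eq
    by (meson le_infI order_trans)
  then have "Kjoin x x' \<subseteq> {s. y \<le> f s}" if "\<forall>s\<in>x. y \<le> f s" "\<forall>s\<in>x'. y \<le> f s" for x x' y
    using that by (subst Kjoin_subset_iff) auto
  then show ?thesis
    unfolding biideal_def biideal_of_def
    by (auto simp: jle_sup_iff jle_Kjoin_iff) (meson order_trans subsetD)
qed

lemma biideal_of_subset:
  assumes I: "Kbiideal I" and f: "\<And>s. (principal s, f s) \<in> I"
  shows "biideal_of f \<subseteq> I"
proof (rule subrelI)
  fix x y
  assume "(x, y) \<in> biideal_of f"
  then have "x \<in> Kcar" and y: "\<And>s. s \<in> x \<Longrightarrow> y \<le> f s" by (auto simp: biideal_of_def)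
  have p: "(principal s, y) \<in> I" if "s \<in> x" for s
    using Kbiideal_down[OF I f[of s]] y[OF that] by simp
  from \<open>x \<in> Kcar\<close> show "(x, y) \<in> I"
  proof (cases rule: Kcar_cases)
    case empty
    then show ?thesis using Kbiideal_empty[OF I] by simp
  next
    case C
    then show ?thesis using p[of Cs] by simp
  next
    case (A m)
    then show ?thesis using p[of "As m"] by simp
  next
    case (B n)
    then show ?thesis using p[of "Bs n"] by simp
  next
    case (D m n)
    then have "(Aset m, y) \<in> I" "(Bset n, y) \<in> I" using p[of "As m"] p[of "Bs n"] by auto
    from Kbiideal_Kjoin[OF I this] show ?thesis using D by (simp add: Kjoin_Aset_Bset)
  qed
qed

lemma capped_biideal_of:
  fixes f :: "ksym \<Rightarrow> 'b::bounded_lattice_bot"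
  assumes f: "rule_monotone f"
    and A: "\<And>m. m \<ge> M \<Longrightarrow> f (As m) = f (As M)" and B: "\<And>m. m \<ge> M \<Longrightarrow> f (Bs m) = f (Bs M)"
  shows "capped Kcar Kjoin {} UNIV sup bot (biideal_of f)"
proof -
  \<comment> \<open>The infimum is the largest value allowed on such a set: \<open>f\<close> is
    monotone along the chains, and the infimum lies below \<open>f Cs\<close>.\<close>
  let ?D = "\<lambda>(m, n). ({Cs} \<union> Aset m \<union> Bset n, inf (f (As m)) (f (Bs n)))"
  let ?P = "{(m, n). m \<le> M \<and> n \<le> M \<and> m \<le> n + 1 \<and> n \<le> m + 1}"
  let ?Gam = "{({Cs}, f Cs)} \<union> (\<lambda>m. (Aset m, f (As m))) ` {..M} \<union>
      (\<lambda>m. (Bset m, f (Bs m))) ` {..M} \<union> ?D ` ?P"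
  let ?X = "?Gam \<union> Kcar \<times> {bot} \<union> {{}} \<times> UNIV"
  have "?P \<subseteq> {..M} \<times> {..M}" by auto
  then have "finite ?P" by (rule finite_subset) simp
  then have fin: "finite ?Gam" by simp
  note J = Kbiideal_biideal_of[OF f]
  have princ: "(principal s, f s) \<in> biideal_of f" for s
    by (rule principal_in_biideal_of[OF f])
  have D: "?D p \<in> biideal_of f" if "p \<in> ?P" for p
  proof -
    obtain m n where p: "p = (m, n)" "m \<le> n + 1" "n \<le> m + 1" using \<open>p \<in> ?P\<close> by blast
    have "inf (f (As m)) (f (Bs n)) \<le> f s" if "s \<in> {Cs} \<union> Aset m \<union> Bset n" for s
      using that rule_monotone_mono[OF f] rule_monotone_Cs[OF f]
      by (cases s) (simp_all add: le_infI1 le_infI2)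
    then show ?thesis using Kcar_intros(5)[OF p(2,3)] by (simp add: p(1) biideal_of_def)
  qed
  have sub: "?X \<subseteq> biideal_of f"
    using princ[of Cs] princ[of "As _"] princ[of "Bs _"] D
    by (auto simp: Kbiideal_bot[OF J] Kbiideal_empty[OF J])
  have "biideal_of f = prod_downset Kcar Kjoin UNIV sup ?X"
  proof (rule subset_antisym; rule subrelI)
    fix x y
    assume "(x, y) \<in> prod_downset Kcar Kjoin UNIV sup ?X"
    then have "x \<in> Kcar" "\<exists>p\<in>?X. jle Kjoin x (fst p) \<and> y \<le> snd p"
      unfolding prod_downset_def jle_sup_iff by (simp_all add: case_prod_beta)
    then obtain p where p: "p \<in> ?X" "jle Kjoin x (fst p)" "y \<le> snd p" by (elim bexE conjE)
    have J': "(fst p, snd p) \<in> biideal_of f" using subsetD[OF sub p(1)] by simp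
    have "x \<subseteq> fst p"
      using p(2) \<open>x \<in> Kcar\<close> Kbiideal_in_Kcar[OF J J'] by (simp add: jle_Kjoin_iff)
    from Kbiideal_down[OF J J' \<open>x \<in> Kcar\<close> this p(3)] show "(x, y) \<in> biideal_of f" .
  next
    fix x y
    assume xy: "(x, y) \<in> biideal_of f"
    \<comment> \<open>Truncating indices at \<open>M\<close> enlarges the set, keeps the values of
      \<open>f\<close> and preserves the bound on the index difference, so finitely many pairs cover
      everything.\<close>
    have A': "f (As (min m M)) = f (As m)" for m using A[of m] by (simp add: min_def)
    have B': "f (Bs (min m M)) = f (Bs m)" for m using B[of m] by (simp add: min_def)
    from xy have x: "x \<in> Kcar" and y: "\<And>s. s \<in> x \<Longrightarrow> y \<le> f s" by (auto simp: biideal_of_def)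
    have cover: "(x, y) \<in> prod_downset Kcar Kjoin UNIV sup ?X"
      if "p \<in> ?X" "x \<subseteq> fst p" "y \<le> snd p" for p
    proof -
      have "(fst p, snd p) \<in> biideal_of f" using subsetD[OF sub that(1)] by simp
      then have "jle Kjoin x (fst p)"
        using x that(2) Kbiideal_in_Kcar[OF J, of "fst p" "snd p"] by (simp add: jle_Kjoin_iff)
      then have "\<exists>p\<in>?X. jle Kjoin x (fst p) \<and> jle sup y (snd p)"
        using that(3) by (intro bexI[OF _ that(1)]) (simp add: jle_sup_iff)
      then show ?thesis using x unfolding prod_downset_def by (simp add: case_prod_beta)
    qed
    from x show "(x, y) \<in> prod_downset Kcar Kjoin UNIV sup ?X"
    proof (cases rule: Kcar_cases)
      case empty
      then show ?thesis by (intro cover[of "({}, y)"]) simp_all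
    next
      case C
      then show ?thesis using y[of Cs] by (intro cover[of "({Cs}, f Cs)"]) simp_all
    next
      case (A m)
      then show ?thesis using y[of "As m"]
        by (intro cover[of "(Aset (min m M), f (As (min m M)))"]) (auto simp: A' Aset_def)
    next
      case (B m)
      then show ?thesis using y[of "Bs m"]
        by (intro cover[of "(Bset (min m M), f (Bs (min m M)))"]) (auto simp: B' Bset_def)
    next
      case (D m n)
      show ?thesis
      proof (rule cover)
        have "(min m M, min n M) \<in> ?P" using D by auto
        then show "?D (min m M, min n M) \<in> ?X" by (intro UnI1 UnI2 imageI)
        show "x \<subseteq> fst (?D (min m M, min n M))" using D by (auto simp: Aset_def Bset_def)
        show "y \<le> snd (?D (min m M, min n M))"
          using D y[of "As m"] y[of "Bs n"] A' B' by simp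
      qed
    qed
  qed
  moreover have "?Gam \<subseteq> Kcar \<times> UNIV"
    by (rule subset_trans[OF _ biideal_carrierD[OF J]], rule subset_trans[OF _ sub]) blast
  ultimately show ?thesis unfolding capped_def using fin by (intro exI[of _ ?Gam] conjI)
qed

text \<open>A member of \<open>K\<close> meets each chain in a final segment or not at all; finitely
  many members have a common threshold.\<close>

lemma Kcar_eventually_const:
  assumes "finite X" "\<And>x. x \<in> X \<Longrightarrow> x \<in> Kcar"
  shows "\<exists>N. \<forall>x\<in>X. \<forall>m\<ge>N. (As m \<in> x \<longleftrightarrow> As N \<in> x) \<and> (Bs m \<in> x \<longleftrightarrow> Bs N \<in> x)"
proof -
  have "\<exists>N. \<forall>m\<ge>N. (As m \<in> x \<longleftrightarrow> As N \<in> x) \<and> (Bs m \<in> x \<longleftrightarrow> Bs N \<in> x)" if "x \<in> Kcar" for x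
    using that
  proof (cases rule: Kcar_cases)
    case (D m n)
    then show ?thesis by (intro exI[of _ "max m n"]) auto
  qed (auto intro: order_trans)
  then have "\<forall>x\<in>X. \<exists>N. \<forall>m\<ge>N. (As m \<in> x \<longleftrightarrow> As N \<in> x) \<and> (Bs m \<in> x \<longleftrightarrow> Bs N \<in> x)"
    using assms(2) by blast
  then obtain n where n: "\<And>x m. x \<in> X \<Longrightarrow> m \<ge> n x \<Longrightarrow> (As m \<in> x \<longleftrightarrow> As (n x) \<in> x) \<and> (Bs m \<in> x \<longleftrightarrow> Bs (n x) \<in> x)"
    by metis
  obtain N where N: "\<And>x. x \<in> X \<Longrightarrow> n x \<le> N"
    using finite_nat_set_iff_bounded_le[of "n ` X"] assms(1) by auto
  have "(As m \<in> x \<longleftrightarrow> As N \<in> x) \<and> (Bs m \<in> x \<longleftrightarrow> Bs N \<in> x)" if "x \<in> X" "m \<ge> N" for x m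
    using n[of x m] n[of x N] N[of x] that by auto
  then show ?thesis by blast
qed

section \<open>Closing up a finite set of generators\<close>

text \<open>The least solution of the rules above \<open>v\<close> once its value \<open>c\<close> at \<open>Cs\<close> is known.\<close>

function fill :: "(ksym \<Rightarrow> 'b::lattice) \<Rightarrow> 'b \<Rightarrow> ksym \<Rightarrow> 'b" where
  "fill v c Cs = c"
| "fill v c (As 0) = v (As 0)"
| "fill v c (Bs 0) = v (Bs 0)"
| "fill v c (As (Suc m)) = sup (v (As (Suc m))) (sup (fill v c (As m)) (inf c (fill v c (Bs m))))"
| "fill v c (Bs (Suc m)) = sup (v (Bs (Suc m))) (sup (fill v c (Bs m)) (inf c (fill v c (As m))))"

  by pat_completeness auto
termination
  by (relation "measure (\<lambda>(v, c, s). case s of Cs \<Rightarrow> 0 | As m \<Rightarrow> m | Bs m \<Rightarrow> m)") auto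

lemma fill_ge: "s \<noteq> Cs \<Longrightarrow> v s \<le> fill v c s"
  by (cases "(v, c, s)" rule: fill.cases) auto

text \<open>Constants above \<open>v\<close> that respect the two crossing rules are never exceeded
  by the recursion. They will be the final values of the iteration.\<close>

lemma fill_le:
  assumes "\<And>m. v (As m) \<le> a" "\<And>m. v (Bs m) \<le> b" "inf c b \<le> a" "inf c a \<le> b"
  shows "fill v c (As m) \<le> a \<and> fill v c (Bs m) \<le> b"
proof (induction m)
  case (Suc m)
  then have "inf c (fill v c (Bs m)) \<le> a" "inf c (fill v c (As m)) \<le> b"
    using assms(3,4) by (meson inf_mono order_refl order_trans)+
  then show ?case using Suc assms by simp
qed (use assms in simp)

lemma fill_in_Kbiideal:
  assumes I: "Kbiideal I" and v: "\<And>s. (principal s, v s) \<in> I" and c: "({Cs}, c) \<in> I"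
  shows "(principal s, fill v c s) \<in> I"
proof -
  have "(Aset m, fill v c (As m)) \<in> I \<and> (Bset m, fill v c (Bs m)) \<in> I" for m
  proof (induction m)
    case 0
    show ?case using v[of "As 0"] v[of "Bs 0"] by simp
  next
    case (Suc m)
    then have "(Aset (Suc m), fill v c (As m)) \<in> I" "(Bset (Suc m), fill v c (Bs m)) \<in> I"
      by (auto intro: Kbiideal_Aset_mono[OF I] Kbiideal_Bset_mono[OF I])
    moreover have "(Aset (Suc m), v (As (Suc m))) \<in> I" "(Bset (Suc m), v (Bs (Suc m))) \<in> I"
      using v[of "As (Suc m)"] v[of "Bs (Suc m)"] by auto
    ultimately show ?case
      using Suc Kbiideal_sup[OF I] Kbiideal_Aset_Suc[OF I c] Kbiideal_Bset_Suc[OF I c] by auto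
  qed
  then show ?thesis using c by (cases s) auto
qed

text \<open>The recursion builds in every rule except the one concluding \<open>Cs\<close>, whose
  value \<open>c\<close> is prescribed; the bounds \<open>a\<close> and \<open>b\<close> supply that
  one.\<close>

lemma rule_monotone_fill:
  assumes "\<And>m. fill v c (As m) \<le> a" "\<And>m. fill v c (Bs m) \<le> b" "inf a b \<le> c"
  shows "rule_monotone (fill v c)"
proof -
  have "inf (fill v c (As m)) (fill v c (Bs m)) \<le> c" for m
    using assms by (meson inf_mono order_trans)
  then show ?thesis
    unfolding rule_monotone_def by (auto intro: le_supI2)
qed

lemma tensor_elem_capped:
  fixes I :: "(ksym set \<times> 'b::bounded_lattice_bot) set"
  assumes mod: "h_modular h (UNIV :: 'b set) sup inf"
    and "tensor_elem Kcar Kjoin {} UNIV sup bot I"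
  shows "capped Kcar Kjoin {} UNIV sup bot I"
proof -
  have I: "Kbiideal I" using assms(2) by (simp add: tensor_elem_def)
  obtain P where P: "finite P" "P \<subseteq> I" "\<forall>J. Kbiideal J \<longrightarrow> P \<subseteq> J \<longrightarrow> I \<subseteq> J"
    using tensor_elem_finitely_generated[OF assms(2)] .
  have PK: "fst p \<in> Kcar" if "p \<in> P" for p
    using that P(2) I unfolding biideal_def by auto
  \<comment> \<open>\<open>v s\<close> joins the second coordinates of all generators whose first
    coordinate contains \<open>s\<close>; \<open>bot\<close> serves symbols that occur in
    none.\<close>
  define Y where "Y s = snd ` {p \<in> P. s \<in> fst p}" for s
  define v where "v s = Sup_fin (insert bot (Y s))" for s
  have finY: "finite (Y s)" for s using P(1) by (simp add: Y_def)
  have v_ge: "y \<le> v s" if "(x, y) \<in> P" "s \<in> x" for x y s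
  proof -
    have "y \<in> Y s" using that by (force simp: Y_def)
    then show ?thesis unfolding v_def using finY by (intro Sup_fin.coboundedI) auto
  qed
  have v_I: "(principal s, v s) \<in> I" for s
    unfolding v_def
  proof (rule Sup_fin_in_section[OF I _ finY])
    show "\<forall>y\<in>Y s. (principal s, y) \<in> I"
    proof
      fix y assume "y \<in> Y s"
      then obtain p where p: "p \<in> P" "s \<in> fst p" "y = snd p" by (auto simp: Y_def)
      then have "(fst p, y) \<in> I" using P(2) by auto
      then show "(principal s, y) \<in> I"
        by (rule Kbiideal_down[OF I]) (use p PK principal_subset in auto)
    qed
  qed simp

  have v_mono': "v s \<le> v t" if "\<And>p. p \<in> P \<Longrightarrow> s \<in> fst p \<Longrightarrow> t \<in> fst p" for s t
  proof -
    have "Y s \<subseteq> Y t" unfolding Y_def using that by (intro image_mono) auto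
    then show ?thesis unfolding v_def using finY by (intro Sup_fin.subset_imp) auto
  qed
  have "v (As m) \<le> v (As (Suc m))" "v (Bs m) \<le> v (Bs (Suc m))" for m
    using PK by (auto intro!: v_mono' simp: Kcar_iff_Kclosed Kclosed_def simp del: fst_conv)
  then have v_mono: "v (As m) \<le> v (As k)" "v (Bs m) \<le> v (Bs k)" if "m \<le> k" for m k
    using that lift_Suc_mono_le[of "\<lambda>m. v (As m)"] lift_Suc_mono_le[of "\<lambda>m. v (Bs m)"] by blast+

  \<comment> \<open>From \<open>N\<close> on, no generator distinguishes symbols of the same chain,
    so \<open>v (As N)\<close> and \<open>v (Bs N)\<close> are the largest values on the
    chains.\<close>
  have "\<exists>N. \<forall>x\<in>fst ` P. \<forall>m\<ge>N. (As m \<in> x \<longleftrightarrow> As N \<in> x) \<and> (Bs m \<in> x \<longleftrightarrow> Bs N \<in> x)"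
    by (rule Kcar_eventually_const) (use P(1) PK in auto)
  then obtain N where
    N: "\<forall>x\<in>fst ` P. \<forall>m\<ge>N. (As m \<in> x \<longleftrightarrow> As N \<in> x) \<and> (Bs m \<in> x \<longleftrightarrow> Bs N \<in> x)" by (elim exE)
  have "v (As (max m N)) \<le> v (As N)" "v (Bs (max m N)) \<le> v (Bs N)" for m
    using bspec[OF N, rule_format, of _ "max m N"] by (intro v_mono'; simp)+
  then have v_le: "v (As m) \<le> v (As N)" "v (Bs m) \<le> v (Bs N)" for m
    using v_mono[of m "max m N"] by (meson max.cobounded1 order_trans)+

  define u where "u k = (hstep sup inf ^^ k) (v Cs, v (As N), v (Bs N))" for k
  define c where "c k = fst (u k)" for k
  define a where "a k = fst (snd (u k))" for k
  define b where "b k = snd (snd (u k))" for k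
  have u: "u k = (c k, a k, b k)" for k by (simp add: a_def b_def c_def)
  have "u (Suc k) = hstep sup inf (u k)" for k by (simp add: u_def)
  then have step: "c (Suc k) = sup (c k) (inf (a k) (b k))" "a (Suc k) = sup (a k) (inf (c k) (b k))"
    "b (Suc k) = sup (b k) (inf (c k) (a k))" for k
    unfolding u hstep_def by auto
  have zero: "c 0 = v Cs" "a 0 = v (As N)" "b 0 = v (Bs N)"
    by (simp_all add: a_def b_def c_def u_def)
  have "u (Suc h) = u h"
    using mod unfolding u_def h_modular_def Suc_eq_plus1 by blast
  then have "c (Suc h) = c h" "a (Suc h) = a h" "b (Suc h) = b h" unfolding u by auto
  \<comment> \<open>By \<open>h\<close>-modularity the triple stops at \<open>h\<close>, and a
    stopped triple satisfies the three binary rules.\<close>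
  then have fixed: "inf (a h) (b h) \<le> c h" "inf (c h) (b h) \<le> a h" "inf (c h) (a h) \<le> b h"
    unfolding step by (metis sup.cobounded2)+
  have c_mono: "c k \<le> c l" and a_mono: "a k \<le> a l" and b_mono: "b k \<le> b l" if "k \<le> l" for k l
    using that by (auto intro: lift_Suc_mono_le simp: step)
  \<comment> \<open>Each crossing rule raises the index by one, so the \<open>k\<close>-th iterate
    sits at \<open>N + k\<close>. The part needed later is that \<open>c h\<close> is a legitimate
    value at \<open>Cs\<close>.\<close>
  have "({Cs}, c k) \<in> I \<and> (Aset (N + k), a k) \<in> I \<and> (Bset (N + k), b k) \<in> I" for k
  proof (induction k)
    case 0
    show ?case using v_I[of Cs] v_I[of "As N"] v_I[of "Bs N"] by (simp add: zero)
  next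
    case (Suc k)
    then have "(Aset (N + Suc k), a k) \<in> I" "(Bset (N + Suc k), b k) \<in> I"
      by (auto intro: Kbiideal_Aset_mono[OF I] Kbiideal_Bset_mono[OF I])
    then show ?case
      using Suc Kbiideal_sup[OF I] Kbiideal_Cs[OF I] Kbiideal_Aset_Suc[OF I] Kbiideal_Bset_Suc[OF I]
      by (simp add: step)
  qed
  then have c_I: "({Cs}, c h) \<in> I" by blast

  define f where "f = fill v (c h)"
  have f_le: "f (As m) \<le> a h \<and> f (Bs m) \<le> b h" for m
    unfolding f_def
  proof (rule fill_le)
    show "v (As m) \<le> a h" "v (Bs m) \<le> b h" for m
      using v_le[of m] a_mono[of 0 h] b_mono[of 0 h] unfolding zero by (auto intro: order_trans)
  qed (use fixed in auto)
  then have f: "rule_monotone f"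
    unfolding f_def using fixed(1) by (intro rule_monotone_fill) auto
  \<comment> \<open>One unfolding of \<open>fill\<close> dominates one step of the iteration,
    because it uses \<open>c h\<close> where the iteration uses the smaller
    \<open>c k\<close>.\<close>
  have f_ge: "a k \<le> f (As (N + k)) \<and> b k \<le> f (Bs (N + k))" if "k \<le> h" for k
    using that
  proof (induction k)
    case 0
    show ?case unfolding f_def zero by (simp add: fill_ge)
  next
    case (Suc k)
    then have "a k \<le> f (As (N + k))" "b k \<le> f (Bs (N + k))" "c k \<le> c h" using c_mono by auto
    then have "sup (a k) (inf (c k) (b k)) \<le> sup (f (As (N + k))) (inf (c h) (f (Bs (N + k))))"
      "sup (b k) (inf (c k) (a k)) \<le> sup (f (Bs (N + k))) (inf (c h) (f (As (N + k))))"
      by (simp_all only: sup_mono inf_mono)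
    then show ?case
      unfolding f_def step add_Suc_right fill.simps by (intro conjI le_supI2[of _ "sup _ _"])
  qed
  have const: "f (As m) = a h" "f (Bs m) = b h" if "m \<ge> N + h" for m
    using f_le[of m] f_ge[of h] rule_monotone_mono[OF f that] by (auto intro: antisym order_trans)
  have "v s \<le> f s" for s
    using c_mono[of 0 h] unfolding f_def zero by (cases "s = Cs") (simp_all add: fill_ge)
  \<comment> \<open>Containing the generators gives one inclusion; the other holds because every
    value of \<open>fill\<close> is obtained by rules valid inside \<open>I\<close>.\<close>
  then have "P \<subseteq> biideal_of f"
    using PK v_ge by (force simp: biideal_of_def intro: order_trans)
  then have "I \<subseteq> biideal_of f" by (rule P(3)[rule_format, OF Kbiideal_biideal_of[OF f]])
  moreover have "biideal_of f \<subseteq> I"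
    by (rule biideal_of_subset[OF I]) (unfold f_def, rule fill_in_Kbiideal[OF I v_I c_I])
  ultimately have "I = biideal_of f" by blast
  moreover have "capped Kcar Kjoin {} UNIV sup bot (biideal_of f)"
    by (rule capped_biideal_of[OF f, of "N + h"]) (simp_all add: const)
  ultimately show ?thesis by simp
qed

theorem theorem5p13:
  shows "(infinite Kcar \<and> generated_by_three Kcar Kjoin Kmeet \<and> h_modular 2 Kcar Kjoin Kmeet)
    \<and> (\<forall>h::nat. h > 0 \<longrightarrow>
           h_modular h (UNIV :: 'b::bounded_lattice_bot set) sup inf \<longrightarrow>
           capped_tensor Kcar Kjoin {} (UNIV :: 'b set) sup bot)"
  using infinite_Kcar generated_by_three_Kcar h_modular_Kcar tensor_elem_capped
  unfolding capped_tensor_def by blast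

end
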